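(* (Polynomial Perturbation Lemma.) Let $k$ be a positive integer. Let $a_1<a_2<\cdots<a_k$ be a strictly increasing sequence of positive integers. Let $g_1,\ldots,g_k\ge 0$ be real numbers satisfying $g_i\le i$ for all $i=1,\ldots,k$. Define \begin{align*} P(z):=\ &(z+a_k)(z+a_{k-1})\cdots(z+a_1)+g_1(z+a_k)(z+a_{k-1})\cdots(z+a_2)\\ &+g_1g_2(z+a_k)(z+a_{k-1})\cdots(z+a_3)+\cdots+g_1g_2\cdots g_{k-1}(z+a_k)+g_1g_2\cdots g_k, \end{align*} that is, $P(z)=\sum_{i=0}^{k}g_1\cdots g_i\prod_{j=i+1}^{k}(z+a_j)$. If $z$ is a complex root of $P(z)$, then $|z|\le a_k+1$.
   Context: Empty products are equal to $1$. *)

theory Defs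
  imports Complex_Main "HOL-Computational_Algebra.Polynomial"
begin

(* The families a and g are indexed from 1; their values outside {1..k} are irrelevant.
   The linear factor z + a j is the polynomial [:a j, 1:]. *)
definition perturb_poly :: "nat \<Rightarrow> (nat \<Rightarrow> nat) \<Rightarrow> (nat \<Rightarrow> real) \<Rightarrow> complex poly" where
  "perturb_poly k a g =
    (\<Sum>i=0..k. smult (complex_of_real (\<Prod>l=1..i. g l)) (\<Prod>j=i+1..k. [:of_nat (a j), 1:]))"

end

theory Submission
  imports Defs
begin

text \<open>
  Write \<open>T i = g 1 \<cdots> g i * (z + a (i+1)) \<cdots> (z + a k)\<close> for the \<open>i\<close>-th summand of \<open>P z\<close>. Suppose
  \<open>cmod z > a k + 1\<close>. Then \<open>cmod (z + a j) > k - j + 1\<close>, hence \<open>cmod (T i) \<le> cmod (T 0) / (k choose i)\<close>;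
  but the summands \<open>T 0\<close> and \<open>T k\<close> may then have almost equal size, so the triangle inequality
  alone does not exclude \<open>P z = 0\<close>. Indeed the bound is attained for odd \<open>k\<close>, by \<open>g i = i\<close> and
  consecutive \<open>a i\<close> at \<open>z = - (a k + 1)\<close>, where \<open>P z\<close> is proportional to the alternating sum of
  the \<open>1 / (k choose i)\<close>. In that case the sum telescopes once it is multiplied by a suitable
  linear factor, and the same factor works in general (as in the proof of the
  Enestrom-Kakeya theorem).

  Since \<open>(z + a i) * T i = g i * T (i - 1)\<close>, multiplication by \<open>z + l\<close> turns \<open>P z\<close> into
  \<open>(z + l + g 1) * T 0 - (\<Sum>i = 1..k. (a i - l - g (i+1)) * T i)\<close>, with \<open>g (k+1) = 0\<close>
  (\<open>abel_summation_linear_factor\<close>). For \<open>l = a 1 - 2\<close> all the weights \<open>a i - l - g (i+1)\<close> are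
  nonnegative, because \<open>a i - l \<ge> i + 1 \<ge> g (i+1)\<close>, and they vanish for \<open>i < k\<close> in the extremal
  case. Now the triangle inequality is sharp enough: working down from \<open>i = k\<close>, the weighted tails of
  the sum are bounded by \<open>majorant\<close> (\<open>weighted_tail_bound\<close>), a perturbation of the binomial
  coefficients \<open>(k+1) choose i\<close> that come out when the \<open>a i\<close> are consecutive. The resulting bound is
  smaller than \<open>cmod ((z + l + g 1) * T 0)\<close> (\<open>norm_two_factors_lower\<close>), so \<open>P z \<noteq> 0\<close>.
\<close>

section \<open>Multiplying by a linear factor\<close>

lemma abel_summation_linear_factor:
  fixes z l :: "'a::comm_ring_1" and a g T :: "nat \<Rightarrow> 'a"
  assumes rec: "\<And>i. i \<in> {1..k} \<Longrightarrow> (z + a i) * T i = g i * T (i - 1)"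
    and last: "g (Suc k) = 0"
  shows "(z + l) * (\<Sum>i=0..k. T i) =
         (z + l + g 1) * T 0 - (\<Sum>i=1..k. (a i - l - g (Suc i)) * T i)"
proof -
  have "(\<Sum>i=1..k. g i * T (i - 1)) = (\<Sum>i=1..Suc k. g i * T (i - 1))"
    using last by simp
  also have "\<dots> = (\<Sum>i=0..k. g (Suc i) * T i)"
    using sum.shift_bounds_cl_Suc_ivl[of "\<lambda>i. g i * T (i - 1)" 0 k] by simp
  also have "\<dots> = g 1 * T 0 + (\<Sum>i=1..k. g (Suc i) * T i)"
    by (simp add: sum.atLeast_Suc_atMost)
  finally have shift:
    "(\<Sum>i=1..k. g i * T (i - 1)) = g 1 * T 0 + (\<Sum>i=1..k. g (Suc i) * T i)" .
  have "(z + l) * (\<Sum>i=0..k. T i) = (z + l) * T 0 + (\<Sum>i=1..k. (z + l) * T i)"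
    by (simp add: sum.atLeast_Suc_atMost sum_distrib_left distrib_left)
  also have "(\<Sum>i=1..k. (z + l) * T i) = (\<Sum>i=1..k. g i * T (i - 1) - (a i - l) * T i)"
    by (rule sum.cong[OF refl], subst rec[symmetric]) (auto simp: algebra_simps)
  also have "\<dots> = (\<Sum>i=1..k. g i * T (i - 1)) - (\<Sum>i=1..k. (a i - l) * T i)"
    by (simp add: sum_subtractf)
  finally show ?thesis
    unfolding shift by (simp add: algebra_simps sum.distrib sum_subtractf)
qed

section \<open>A majorant for the tails\<close>

text \<open>
  Let \<open>D = a k - a 1 - (k - 1)\<close> be the number of integers missing between the \<open>a i\<close>. The worst case for
  the tails is \<open>y k = k + 1 + D\<close>, \<open>(k + 1 - i) * y i = D + (i + 1) * y (i+1)\<close>, whose solution is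
  \<open>((k+1) choose i) * (1 + D / (k+1) * (\<Sum>j=i..k. 1 / (k choose j)))\<close>. Estimating
  \<open>1 / (k choose j) \<le> 1 / k\<close> for \<open>j < k\<close> gives the following explicit supersolution.
\<close>

definition majorant :: "nat \<Rightarrow> real \<Rightarrow> nat \<Rightarrow> real" where
  "majorant k D i =
     real (Suc k choose i) * (1 + D * (2 * real k - real i) / (real k * real (Suc k)))"

lemma majorant_ge_1:
  assumes "D \<ge> 0" "i \<le> k"
  shows "majorant k D i \<ge> 1"
proof -
  have "real (Suc k choose i) \<ge> 1"
    using assms(2) by (simp add: Suc_le_eq del: binomial_Suc_Suc)
  moreover have "1 + D * (2 * real k - real i) / (real k * real (Suc k)) \<ge> 1"
    using assms by simp
  ultimately show ?thesis
    unfolding majorant_def using mult_mono[of 1 _ 1] by fastforce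
qed

lemma majorant_top:
  assumes "k \<ge> 1"
  shows "majorant k D k = real k + 1 + D"
proof -
  have "D * (2 * real k - real k) / (real k * real (Suc k)) = D / real (Suc k)"
    using assms by simp
  then have "majorant k D k = real (Suc k) * (1 + D / real (Suc k))"
    unfolding majorant_def by simp
  also have "\<dots> = real (Suc k) + D"
    by (simp add: distrib_left del: of_nat_Suc)
  finally show ?thesis by simp
qed

lemma binomial_ge_top:
  assumes "1 \<le> i" "i < k"
  shows "k \<le> k choose i"
  using assms
proof (induction k arbitrary: i)
  case (Suc k)
  then obtain j where i: "i = Suc j" by (cases i) auto
  show ?case
  proof (cases "i = k")
    case True
    then show ?thesis by (simp add: binomial_symmetric[of k "Suc k"])
  next
    case False
    then have "k \<le> k choose i" using Suc by simp
    moreover have "1 \<le> k choose j" using Suc.prems i by (simp add: Suc_le_eq)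
    ultimately show ?thesis using i by simp
  qed
qed simp

lemma majorant_step:
  assumes "1 \<le> i" "i < k" "D \<ge> 0"
  shows "D + real (Suc i) * majorant k D (Suc i) \<le> majorant k D i * (real k + 1 - real i)"
proof -
  define x where "x j = 1 + D * (2 * real k - real j) / (real k * real (Suc k))" for j :: nat
  define w where "w = real (Suc k) * real (k choose i)"
  \<comment> \<open>Both binomial coefficients become the same weight \<open>w\<close>.\<close>
  have "Suc i * (Suc k choose Suc i) = Suc k * (k choose i)"
    by (rule Suc_times_binomial)
  then have w1: "real (Suc i) * real (Suc k choose Suc i) = w"
    unfolding w_def of_nat_mult[symmetric] by (rule arg_cong)
  have "(Suc k - i) * (Suc k choose i) = Suc k * (k choose i)"
    using binomial_absorb_comp[of "Suc k" i] by (simp del: binomial_Suc_Suc)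
  then have "real (Suc k - i) * real (Suc k choose i) = w"
    unfolding w_def of_nat_mult[symmetric] by (rule arg_cong)
  then have w2: "real (Suc k choose i) * (real k + 1 - real i) = w"
    using assms by (simp add: of_nat_diff mult.commute add.commute del: binomial_Suc_Suc)
  have "w \<ge> real (Suc k) * real k"
    unfolding w_def using binomial_ge_top[OF assms(1,2)] by (intro mult_left_mono) auto
  then have "D / (real k * real (Suc k)) * (real k * real (Suc k))
      \<le> D / (real k * real (Suc k)) * w"
    using assms by (intro mult_left_mono) (auto simp: mult.commute)
  then have "D \<le> w * (D / (real k * real (Suc k)))"
    using assms by (simp add: mult.commute)
  also have "D / (real k * real (Suc k)) = x i - x (Suc i)"
    unfolding x_def by (simp add: diff_divide_distrib[symmetric] algebra_simps)
  finally have "D + w * x (Suc i) \<le> w * x i" by (simp add: algebra_simps)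
  moreover have "real (Suc i) * majorant k D (Suc i) = w * x (Suc i)"
    unfolding majorant_def x_def w1[symmetric] by (simp only: mult.assoc)
  moreover have "majorant k D i * (real k + 1 - real i) = w * x i"
    unfolding majorant_def x_def w2[symmetric] by (simp only: mult_ac)
  ultimately show ?thesis by simp
qed

lemma majorant_2_le:
  assumes "k \<ge> 2" "D \<ge> 0"
  shows "2 * majorant k D 2 \<le> (real k + D) * (real k + 1 + D)"
proof -
  have "Suc k choose 2 = Suc k * k div 2" by (simp add: choose_two)
  moreover have "even (Suc k * k)" by simp
  ultimately have "2 * (Suc k choose 2) = Suc k * k" by simp
  then have "2 * real (Suc k choose 2) = real (Suc k) * real k"
    by (metis of_nat_mult of_nat_numeral)
  then have "2 * majorant k D 2 =
      real (Suc k) * real k * (1 + D * (2 * real k - 2) / (real k * real (Suc k)))"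
    unfolding majorant_def by simp
  also have "\<dots> = real (Suc k) * real k + D * (2 * real k - 2)"
    using assms by (simp add: distrib_left del: of_nat_Suc)
  also have "\<dots> \<le> (real k + D) * (real k + 1 + D)"
    using assms by (simp add: algebra_simps)
  finally show ?thesis .
qed

text \<open>
  The induction runs down from \<open>i = k\<close>. In each step the new weight and the old bound
  combine to \<open>a i - l + g (i+1) * (y (i+1) - 1)\<close>.
  This grows with \<open>g (i+1)\<close>, since the majorant is at least \<open>1\<close>, and with \<open>a i\<close>, while the divisor
  \<open>r - a i\<close> decreases with \<open>a i\<close>. So the worst case is that \<open>g (i+1) = i + 1\<close> and that \<open>a i\<close> is as large
  as possible, and there \<open>majorant_step\<close> applies.
\<close>

lemma weighted_tail_bound:
  fixes a g t :: "nat \<Rightarrow> real" and r l D :: real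
  assumes "D \<ge> 0"
    and t: "\<And>i. t i \<ge> 0"
    and rec: "\<And>i. i \<in> {1..k} \<Longrightarrow> (r - a i) * t i \<le> g i * t (i - 1)"
    and g: "\<And>i. i \<in> {1..k} \<Longrightarrow> g i \<le> real i" "g (Suc k) = 0"
    and a_le: "\<And>i. i \<in> {1..k} \<Longrightarrow> a i \<le> l + real i + 1 + D"
    and r: "\<And>i. i \<in> {1..k} \<Longrightarrow> r - a i \<ge> real k + 1 - real i"
    and "1 \<le> i" "i \<le> k"
  shows "(\<Sum>j=i..k. (a j - l - g (Suc j)) * t j) \<le> majorant k D i * (g i * t (i - 1))"
proof -
  have close: "c * t i \<le> majorant k D i * (g i * t (i - 1))"
    if i: "1 \<le> i" "i \<le> k" and c: "c \<le> majorant k D i * (real k + 1 - real i)" for i c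
  proof -
    have m: "majorant k D i \<ge> 0" using majorant_ge_1[of D i k] \<open>D \<ge> 0\<close> i by simp
    have "c \<le> majorant k D i * (r - a i)"
      using c mult_left_mono[OF r m, of i] i by simp
    then have "c * t i \<le> majorant k D i * (r - a i) * t i"
      using t by (rule mult_right_mono)
    also have "\<dots> \<le> majorant k D i * (g i * t (i - 1))"
      using mult_left_mono[OF rec m, of i] i by (simp add: mult.assoc)
    finally show ?thesis .
  qed
  show ?thesis
    using \<open>i \<le> k\<close> \<open>1 \<le> i\<close>
  proof (induction i rule: inc_induct)
    case base
    then show ?case
      using close[of k "a k - l"] a_le[of k] majorant_top[of k D] g(2) by simp
  next
    case (step i)
    define y where "y = majorant k D (Suc i)"
    have y: "y \<ge> 1" unfolding y_def using step majorant_ge_1 \<open>D \<ge> 0\<close> by simp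
    have "(\<Sum>j=i..k. (a j - l - g (Suc j)) * t j)
        = (a i - l - g (Suc i)) * t i + (\<Sum>j=Suc i..k. (a j - l - g (Suc j)) * t j)"
      using step by (simp add: sum.atLeast_Suc_atMost)
    also have "\<dots> \<le> (a i - l - g (Suc i)) * t i + y * (g (Suc i) * t i)"
      using step unfolding y_def by simp
    also have "\<dots> = (a i - l + g (Suc i) * (y - 1)) * t i"
      by (simp add: algebra_simps)
    also have "\<dots> \<le> majorant k D i * (g i * t (i - 1))"
    proof (rule close)
      have "g (Suc i) * (y - 1) \<le> real (Suc i) * (y - 1)"
        using g(1)[of "Suc i"] step y by (intro mult_right_mono) auto
      then have "a i - l + g (Suc i) * (y - 1) \<le> D + real (Suc i) * y"
        using a_le[of i] step by (simp add: algebra_simps)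
      also have "\<dots> \<le> majorant k D i * (real k + 1 - real i)"
        unfolding y_def using majorant_step[of i k D] step \<open>D \<ge> 0\<close> by simp
      finally show "a i - l + g (Suc i) * (y - 1) \<le> majorant k D i * (real k + 1 - real i)" .
    qed (use step in auto)
    finally show ?case .
  qed
qed

section \<open>Location of the roots\<close>

text \<open>
  This is applied with \<open>q = a 1 - 2 + g 1\<close> and \<open>b = a 1\<close>, where \<open>q\<close> can be negative if \<open>a 1 = 1\<close>. For
  negative \<open>q\<close>, \<open>cmod (z + q)\<close> alone can be smaller than \<open>cmod z - q\<close>. But for fixed \<open>r = cmod z\<close> the
  square of the product of the two factors is then a concave function of \<open>x = Re z \<in> {-r..r}\<close>, so its
  minimum is at an end point, and \<open>\<bar>q\<bar> \<le> b\<close> makes that the point \<open>x = - r\<close>.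
\<close>

lemma norm_two_factors_lower:
  fixes z :: complex and q b :: real
  assumes "- b \<le> q" "q \<le> cmod z" "0 \<le> b" "b \<le> cmod z"
  shows "(cmod z - q) * (cmod z - b) \<le> cmod (z + of_real q) * cmod (z + of_real b)"
proof (cases "q \<ge> 0")
  case True
  have "cmod z - q \<le> cmod (z + of_real q)" "cmod z - b \<le> cmod (z + of_real b)"
    using norm_diff_ineq[of z "of_real q"] norm_diff_ineq[of z "of_real b"] True assms by auto
  then show ?thesis using assms by (intro mult_mono) auto
next
  case False
  define r x where "r = cmod z" and "x = Re z"
  have sq: "cmod (z + of_real s) ^ 2 = r^2 + s^2 + 2 * s * x" for s
    unfolding r_def x_def cmod_power2 by (simp add: power2_eq_square algebra_simps)
  have x: "- r \<le> x" "x \<le> r"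
    using abs_Re_le_cmod[of z] by (auto simp: r_def x_def)
  \<comment> \<open>The difference of the squares, factored at its root \<open>x = - r\<close>, has a second factor that
      is affine in \<open>x\<close>; it is at least its value at \<open>x = r\<close>, and that is nonnegative.\<close>
  have diff: "(r^2 + q^2 + 2 * q * x) * (r^2 + b^2 + 2 * b * x) - ((r - q) * (r - b))^2
      = (r + x) * (2 * (b + q) * (r^2 + q * b) + 4 * (- q) * b * (r - x))"
    by (simp add: power2_eq_square algebra_simps)
  have "(- q) * b \<le> r * r"
    using assms False by (intro mult_mono) (auto simp: r_def)
  then have "r^2 + q * b \<ge> 0" by (simp add: power2_eq_square)
  then have "2 * (b + q) * (r^2 + q * b) \<ge> 0"
    using assms by (intro mult_nonneg_nonneg[of "2 * (b + q)"]) auto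
  moreover have "4 * (- q) * b * (r - x) \<ge> 0"
    using assms False x
    by (intro mult_nonneg_nonneg[of "4 * (- q) * b"] mult_nonneg_nonneg[of "4 * (- q)"]) auto
  ultimately have coeffs: "2 * (b + q) * (r^2 + q * b) + 4 * (- q) * b * (r - x) \<ge> 0"
    by (rule add_nonneg_nonneg)
  then have "(r + x) * (2 * (b + q) * (r^2 + q * b) + 4 * (- q) * b * (r - x)) \<ge> 0"
    using coeffs x by (intro mult_nonneg_nonneg[of "r + x"]) auto
  then have "((r - q) * (r - b))^2 \<le> (cmod (z + of_real q) * cmod (z + of_real b))^2"
    unfolding power_mult_distrib[of "cmod (z + of_real q)"] sq using diff by linarith
  then show ?thesis
    unfolding r_def by (rule power2_le_imp_le) simp
qed

lemma sum_nonzero_outside_disc: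
  fixes a g :: "nat \<Rightarrow> real" and T :: "nat \<Rightarrow> complex" and z :: complex
  assumes "k \<ge> 1"
    and a1: "a 1 \<ge> 1"
    and gap: "\<And>i j. 1 \<le> i \<Longrightarrow> i \<le> j \<Longrightarrow> j \<le> k \<Longrightarrow> a i + real (j - i) \<le> a j"
    and g0: "\<And>i. i \<in> {1..k} \<Longrightarrow> 0 \<le> g i"
    and g: "\<And>i. i \<in> {1..k} \<Longrightarrow> g i \<le> real i" "g (Suc k) = 0"
    and rec: "\<And>i. i \<in> {1..k} \<Longrightarrow> (z + of_real (a i)) * T i = of_real (g i) * T (i - 1)"
    and T0: "T 0 \<noteq> 0"
    and z: "cmod z > a k + 1"
  shows "(\<Sum>i=0..k. T i) \<noteq> 0"
proof
  assume "(\<Sum>i=0..k. T i) = 0"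
  define D where "D = a k - a 1 - real (k - 1)"
  define l where "l = a 1 - 2"
  define e where "e i = a i - l - g (Suc i)" for i
  define t where "t i = cmod (T i)" for i
  have D: "D \<ge> 0" using gap[of 1 k] \<open>k \<ge> 1\<close> by (simp add: D_def)
  have lower: "a i \<ge> l + real i + 1" if "i \<in> {1..k}" for i
    using gap[of 1 i] that by (simp add: l_def of_nat_diff)
  have upper: "a i \<le> l + real i + 1 + D" "real k - real i \<le> a k - a i" if "i \<in> {1..k}" for i
    using gap[of i k] that \<open>k \<ge> 1\<close> by (simp_all add: l_def D_def of_nat_diff)
  have e_nonneg: "e i \<ge> 0" if "i \<in> {1..k}" for i
  proof (cases "i = k")
    case True
    then show ?thesis using lower[of k] that g(2) by (simp add: e_def)
  next
    case False
    then show ?thesis using lower[of i] that g(1)[of "Suc i"] by (simp add: e_def)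
  qed
  have nrec: "cmod (z + of_real (a i)) * t i = g i * t (i - 1)" if "i \<in> {1..k}" for i
    using arg_cong[OF rec[OF that], of cmod] g0[OF that] by (simp add: norm_mult t_def)
  have rec_le: "(cmod z - a i) * t i \<le> g i * t (i - 1)" if "i \<in> {1..k}" for i
  proof -
    have "a i \<ge> 0" using gap[of 1 i] a1 that by simp
    then have "cmod z - a i \<le> cmod (z + of_real (a i))"
      using norm_diff_ineq[of z "of_real (a i)"] by simp
    then show ?thesis using nrec[OF that] mult_right_mono[of _ _ "t i"] by (fastforce simp: t_def)
  qed

  have "(z + of_real (l + g 1)) * T 0 = (\<Sum>i=1..k. of_real (e i) * T i)"
    using abel_summation_linear_factor[where k=k and z=z and T=T and l="of_real l"
        and a="\<lambda>i. of_real (a i)" and g="\<lambda>i. of_real (g i)"] rec g(2) \<open>(\<Sum>i=0..k. T i) = 0\<close>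
    by (simp add: e_def add.assoc)
  then have "cmod (z + of_real (l + g 1)) * t 0 = cmod (\<Sum>i=1..k. of_real (e i) * T i)"
    unfolding t_def by (simp add: norm_mult[symmetric])
  also have "\<dots> \<le> (\<Sum>i=1..k. e i * t i)"
    by (rule sum_norm_le) (use e_nonneg in \<open>auto simp: norm_mult t_def\<close>)
  also have "\<dots> \<le> (real k + D) * (real k + 1 + D) * t 1"
  proof (cases "k = 1")
    case True
    then show ?thesis using g(2) by (simp add: e_def l_def D_def)
  next
    case False
    then have k: "k \<ge> 2" using \<open>k \<ge> 1\<close> by simp
    define y where "y = majorant k D 2"
    have y: "y \<ge> 1" unfolding y_def using k D majorant_ge_1 by simp
    have "(\<Sum>i=1..k. e i * t i) = e 1 * t 1 + (\<Sum>i=2..k. e i * t i)"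
      using \<open>k \<ge> 1\<close> by (simp add: sum.atLeast_Suc_atMost numeral_2_eq_2)
    also have "(\<Sum>i=2..k. e i * t i) \<le> y * (g 2 * t (2 - 1))"
      unfolding y_def e_def
      by (rule weighted_tail_bound[where r="cmod z"])
        (use D k rec_le g upper z in \<open>force simp: t_def\<close>)+
    finally have "(\<Sum>i=1..k. e i * t i) \<le> (2 + g 2 * (y - 1)) * t 1"
      by (simp add: e_def l_def algebra_simps numeral_2_eq_2)
    also have "\<dots> \<le> (2 * y) * t 1"
      using mult_right_mono[of "g 2" 2 "y - 1"] g(1)[of 2] k y
      by (intro mult_right_mono) (auto simp: t_def)
    also have "\<dots> \<le> (real k + D) * (real k + 1 + D) * t 1"
      using majorant_2_le[OF k D] unfolding y_def by (intro mult_right_mono) (auto simp: t_def)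
    finally show ?thesis .
  qed
  \<comment> \<open>Trading \<open>t 1\<close> for \<open>t 0\<close> by the factor \<open>z + a 1\<close> leaves a product that is estimated jointly.\<close>
  finally have "cmod (z + of_real (a 1)) * (cmod (z + of_real (l + g 1)) * t 0)
      \<le> cmod (z + of_real (a 1)) * ((real k + D) * (real k + 1 + D) * t 1)"
    by (rule mult_left_mono) simp
  also have "\<dots> = (real k + D) * (real k + 1 + D) * (g 1 * t 0)"
    using nrec[of 1] \<open>k \<ge> 1\<close> by (simp add: mult_ac)
  also have "\<dots> \<le> (real k + D) * (real k + 1 + D) * (1 * t 0)"
    using g(1)[of 1] \<open>k \<ge> 1\<close> D by (intro mult_left_mono mult_right_mono) (auto simp: t_def)
  finally have "cmod (z + of_real (a 1)) * cmod (z + of_real (l + g 1))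
      \<le> (real k + D) * (real k + 1 + D)"
    using T0 by (simp add: t_def mult.assoc[symmetric])
  moreover have "(cmod z - (l + g 1)) * (cmod z - a 1)
      \<le> cmod (z + of_real (l + g 1)) * cmod (z + of_real (a 1))"
    by (rule norm_two_factors_lower)
      (use a1 g0[of 1] g(1)[of 1] \<open>k \<ge> 1\<close> z gap[of 1 k] in \<open>auto simp: l_def\<close>)
  moreover have "(real k + 1 + D) * (real k + D) < (cmod z - (l + g 1)) * (cmod z - a 1)"
    by (rule mult_strict_mono)
      (use z g(1)[of 1] \<open>k \<ge> 1\<close> D in \<open>auto simp: l_def D_def of_nat_diff\<close>)
  ultimately show False by (simp add: mult.commute)
qed

theorem lemmaB1:
  fixes k :: nat and a :: "nat \<Rightarrow> nat" and g :: "nat \<Rightarrow> real" and z :: complex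
  assumes "k \<ge> 1"
    and "\<And>i. i \<in> {1..k} \<Longrightarrow> a i > 0"
    and "strict_mono_on {1..k} a"
    and "\<And>i. i \<in> {1..k} \<Longrightarrow> g i \<ge> 0"
    and "\<And>i. i \<in> {1..k} \<Longrightarrow> g i \<le> real i"
    and "poly (perturb_poly k a g) z = 0"
  shows "cmod z \<le> real (a k) + 1"
proof (rule ccontr)
  assume "\<not> cmod z \<le> real (a k) + 1"
  then have z: "cmod z > real (a k) + 1" by simp
  define T where
    "T i = complex_of_real (\<Prod>l=1..i. g l) * (\<Prod>j=Suc i..k. z + of_nat (a j))" for i
  have gap: "a i + (j - i) \<le> a j" if "1 \<le> i" "i \<le> j" "j \<le> k" for i j
    using that(2,3)
  proof (induction j rule: dec_induct)
    case (step j)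
    then have "a j < a (Suc j)"
      using assms(3) that(1) by (auto simp: strict_mono_on_def)
    then show ?case using step by simp
  qed simp
  have gap_real: "real (a i) + real (j - i) \<le> real (a j)" if "1 \<le> i" "i \<le> j" "j \<le> k" for i j
    using gap[OF that] by (simp only: of_nat_add[symmetric] of_nat_le_iff)
  have "(\<Sum>i=0..k. T i) = 0"
    using assms(6) unfolding perturb_poly_def T_def
    by (simp add: poly_sum poly_prod add.commute)
  moreover have "(\<Sum>i=0..k. T i) \<noteq> 0"
  proof (rule sum_nonzero_outside_disc)
    \<comment> \<open>Changing \<open>g (k+1)\<close> to \<open>0\<close> leaves \<open>P\<close> as it is and ends the summation by parts at \<open>i = k\<close>.\<close>
    show "(z + of_real (real (a i))) * T i = of_real ((g(Suc k := 0)) i) * T (i - 1)"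
      if i: "i \<in> {1..k}" for i
    proof -
      obtain m where m: "i = Suc m" using i by (cases i) auto
      have "(\<Prod>j=i..k. z + of_nat (a j)) = (z + of_nat (a i)) * (\<Prod>j=Suc i..k. z + of_nat (a j))"
        using i by (simp add: prod.atLeast_Suc_atMost)
      moreover have "(\<Prod>l=1..i. g l) = g i * (\<Prod>l=1..i - 1. g l)"
        by (simp add: m)
      ultimately show ?thesis
        using i by (auto simp: T_def m mult_ac)
    qed
    have "z + of_nat (a j) \<noteq> 0" if "j \<in> {1..k}" for j
    proof
      assume "z + of_nat (a j) = 0"
      then have "z = - of_nat (a j)" by (simp add: eq_neg_iff_add_eq_0)
      then have "cmod z = real (a j)" by simp
      then show False using z gap_real[of j k] that by simp
    qed
    then show "T 0 \<noteq> 0" by (simp add: T_def)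
  qed (use assms(2)[of 1] assms(1,4,5) gap_real z in \<open>auto simp: Suc_le_eq\<close>)
  ultimately show False by simp
qed

end
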